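(* If $G\subseteq GL_n(\mathbb{R})$ is a finite subgroup that is strictly generated in codimension two, then $\mathcal{A}^G_1=\emptyset$; that is, the subspace arrangement $\mathcal A^G$ contains no hyperplane.
   Context: Let $V=\mathbb R^n$. For $g\in G$, $V^{\langle g\rangle}$ is the subspace of vectors fixed by $g$; for a subgroup $H\subset G$, $V^H$ is the subspace of vectors fixed by every element of $H$. $G$ is strictly generated in codimension two if it is generated by its elements $g$ with $\operatorname{codim}V^{\langle g\rangle}=2$. A subgroup $H\subset G$ is a stabilizer subgroup if $H=\{g\in G\mid gv=v\ \text{for all } v\in V^H\}$. The subspace arrangement of $G$ is $\mathcal A^G=\{V^H\mid \{e\}\neq H \text{ a stabilizer subgroup}\}$, and $\mathcal A^G_1$ is the set of members of $\mathcal A^G$ of codimension one. *)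

theory Defs
  imports "HOL-Analysis.Analysis" "HOL-Algebra.Generated_Groups"
begin

definition GL :: "(real ^ 'n ^ 'n) monoid" where
  "GL = \<lparr>carrier = {A. invertible A}, mult = (**), one = mat 1\<rparr>"

lemma group_GL: "group (GL :: (real ^ 'n ^ 'n) monoid)"
proof (rule groupI)
  fix A :: "real ^ 'n ^ 'n"
  assume "A \<in> carrier GL"
  then obtain B where "A ** B = mat 1" "B ** A = mat 1"
    by (auto simp: GL_def invertible_def)
  then show "\<exists>B\<in>carrier GL. B \<otimes>\<^bsub>GL\<^esub> A = \<one>\<^bsub>GL\<^esub>"
    by (auto simp: GL_def invertible_def)
next
  show "\<one>\<^bsub>GL\<^esub> \<in> carrier (GL :: (real ^ 'n ^ 'n) monoid)"
    by (auto simp: GL_def invertible_def intro!: exI[of _ "mat 1"])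
qed (auto simp: GL_def invertible_mult matrix_mul_assoc)

definition fixed_space :: "(real ^ 'n ^ 'n) set \<Rightarrow> (real ^ 'n) set" where
  "fixed_space H = {v. \<forall>g\<in>H. g *v v = v}"

text \<open>Meant for linear subspaces \<open>W\<close>; the natural-number subtraction never truncates,
  because \<open>dim W \<le> CARD('n)\<close>.\<close>

definition codim :: "(real ^ 'n) set \<Rightarrow> nat" where
  "codim W = CARD('n) - dim W"

text \<open>A vector is fixed by \<open>g\<close> iff it is fixed by the cyclic group generated by \<open>g\<close>, so
  \<open>fixed_space {g}\<close> is the fixed space of that cyclic group.  The trivial group qualifies,
  being generated by the empty set.\<close>

definition strictly_generated_in_codim_two :: "(real ^ 'n ^ 'n) set \<Rightarrow> bool" where
  "strictly_generated_in_codim_two G \<longleftrightarrow>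
     generate GL {g \<in> G. codim (fixed_space {g}) = 2} = G"

definition stabilizer_subgroup :: "(real ^ 'n ^ 'n) set \<Rightarrow> (real ^ 'n ^ 'n) set \<Rightarrow> bool" where
  "stabilizer_subgroup H G \<longleftrightarrow>
     subgroup H GL \<and> H \<subseteq> G \<and> H = {g \<in> G. \<forall>v\<in>fixed_space H. g *v v = v}"

definition subspace_arrangement :: "(real ^ 'n ^ 'n) set \<Rightarrow> (real ^ 'n) set set" where
  "subspace_arrangement G =
     {fixed_space H |H. stabilizer_subgroup H G \<and> H \<noteq> {\<one>\<^bsub>GL\<^esub>}}"

definition subspace_arrangement_codim ::
    "(real ^ 'n ^ 'n) set \<Rightarrow> nat \<Rightarrow> (real ^ 'n) set set" where
  "subspace_arrangement_codim G k = {W \<in> subspace_arrangement G. codim W = k}"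

end

theory Submission
  imports Defs "HOL-Algebra.Multiplicative_Group"
begin

text \<open>Elements of finite order whose fixed space has codimension two have positive determinant,
  hence so has every element of \<open>G\<close>.  An element fixing a hyperplane pointwise is a rank-one update
  of the identity; with finite order it is a reflection or trivial, and a positive determinant
  excludes reflections.\<close>

text \<open>After rotating \<open>p\<close> onto a coordinate axis, the rank-one update only changes one column of
  the identity matrix.\<close>

lemma det_rank_one_update:
  fixes A :: "real ^ 'n ^ 'n"
  assumes A: "\<And>x. A *v x = x + (p \<bullet> x) *\<^sub>R u"
  shows "det A = 1 + p \<bullet> u"
proof -
  obtain k :: 'n where True by simp
  \<comment> \<open>The axis index \<open>k\<close> is arbitrary. Giving \<open>e\<close> the length
    of \<open>p\<close> is what allows an orthogonal map to carry \<open>p\<close> to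
    \<open>e\<close>.\<close>
  define e :: "real ^ 'n" where "e = axis k (norm p)"
  have "norm p = norm e" by (simp add: e_def norm_eq_sqrt_inner[of "axis k _"] inner_axis_axis)
  then obtain f where f: "orthogonal_transformation f" "f p = e"
    using orthogonal_transformation_exists by blast
  define Q where "Q = matrix f"
  have Q: "orthogonal_matrix Q" and lin: "linear f"
    using f by (simp_all add: Q_def orthogonal_transformation_matrix)
  have Qf: "Q *v x = f x" for x
    using lin by (simp add: Q_def matrix_works)
  have inv: "f (transpose Q *v x) = x" for x
  proof -
    have "f (transpose Q *v x) = (Q ** transpose Q) *v x"
      by (simp only: Qf[symmetric] matrix_vector_mul_assoc)
    then show ?thesis using Q by (simp add: orthogonal_matrix_def)
  qed
  have B: "(Q ** A ** transpose Q) *v x = x + (e \<bullet> x) *\<^sub>R f u" for x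
  proof -
    have "(Q ** A ** transpose Q) *v x = f (A *v (transpose Q *v x))"
      by (simp only: Qf[symmetric] matrix_vector_mul_assoc matrix_mul_assoc)
    also have "\<dots> = x + (p \<bullet> (transpose Q *v x)) *\<^sub>R f u"
      by (simp add: A linear_add[OF lin] linear_scale[OF lin] inv del: transpose_matrix_vector)
    also have "p \<bullet> (transpose Q *v x) = f p \<bullet> f (transpose Q *v x)"
      by (simp only: f(1)[unfolded orthogonal_transformation_def, THEN conjunct2, rule_format])
    finally show ?thesis by (simp only: f inv)
  qed
  \<comment> \<open>This is column \<open>k\<close> of the conjugated matrix, since
    \<open>e $ k = norm p\<close>; all other columns are those of the identity. Applied to the
    identity matrix, \<open>cramer_lemma\<close> then evaluates the determinant as
    \<open>x $ k\<close>.\<close>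
  define x where "x = axis k 1 + norm p *\<^sub>R f u"
  have "Q ** A ** transpose Q =
      (\<chi> i j. if j = k then (mat 1 *v x) $ i else (mat 1 :: real^'n^'n) $ i $ j)" (is "_ = ?C")
  proof -
    have "(Q ** A ** transpose Q) $ i $ j = ?C $ i $ j" for i j
    proof -
      have "(Q ** A ** transpose Q) $ i $ j = ((Q ** A ** transpose Q) *v axis j 1) $ i"
        by (simp only: matrix_vector_mult_basis column_def vec_lambda_beta)
      also have "\<dots> = axis j 1 $ i + e $ j * f u $ i"
        unfolding B by (simp add: inner_axis)
      also have "\<dots> = ?C $ i $ j"
        unfolding matrix_vector_mul_lid by (simp add: x_def e_def mat_def axis_def)
      finally show ?thesis .
    qed
    then show ?thesis by (simp only: vec_eq_iff simp_thms)
  qed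
  then have "det (Q ** A ** transpose Q) = x $ k * det (mat 1 :: real^'n^'n)"
    by (simp only: cramer_lemma)
  moreover have "det (Q ** A ** transpose Q) = det A"
  proof -
    have "det Q * det (transpose Q) = 1"
      using Q by (metis det_I det_mul orthogonal_matrix_def)
    then show ?thesis by (simp add: det_mul ac_simps)
  qed
  moreover have "x $ k = 1 + e \<bullet> f u"
    by (simp add: x_def e_def inner_axis')
  moreover have "e \<bullet> f u = p \<bullet> u"
    using f by (auto simp: orthogonal_transformation_def)
  ultimately show ?thesis by simp
qed

text \<open>With \<open>p\<close> normal to \<open>W\<close>, the map \<open>h\<close> adds a
  multiple of \<open>u\<close> given by the functional \<open>p\<close>. Its powers multiply that
  functional by powers of \<open>l = det h\<close>, so finite order and positivity force
  \<open>l = 1\<close>. What remains is a shear, which has finite order only if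
  \<open>u = 0\<close>.\<close>

lemma fixes_hyperplane_imp_mat_1:
  fixes h :: "real ^ 'n ^ 'n"
  assumes m: "m > 0" "((*v) h ^^ m) = id"
    and W: "subspace W" "dim W + 1 = CARD('n)" "\<And>x. x \<in> W \<Longrightarrow> h *v x = x"
    and pos: "det h > 0"
  shows "h = mat 1"
proof -
  have "dim W = DIM(real ^ 'n) - 1" using W(2) by simp
  then obtain p where p: "p \<noteq> 0" "span W = {x. p \<bullet> x = 0}"
    by (rule lowdim_eq_hyperplane)
  with W(1) have eq: "W = {x. p \<bullet> x = 0}" by (simp add: span_eq_iff[THEN iffD2])
  \<comment> \<open>The case \<open>x = p\<close> of the formula for \<open>h\<close> forces this
    value. For general \<open>x\<close>, subtracting the projection \<open>c *\<^sub>R p\<close>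
    onto the normal leaves a vector of \<open>W\<close>.\<close>
  define u where "u = (1 / (p \<bullet> p)) *\<^sub>R (h *v p - p)"
  have h: "h *v x = x + (p \<bullet> x) *\<^sub>R u" for x
  proof -
    define c where "c = (p \<bullet> x) / (p \<bullet> p)"
    have "x - c *\<^sub>R p \<in> W"
      using p by (simp add: eq c_def inner_diff_right)
    then have "h *v x - c *\<^sub>R (h *v p) = x - c *\<^sub>R p"
      using W(3) by (metis matrix_vector_mult_diff_distrib matrix_vector_mult_scaleR)
    then have "h *v x = x + c *\<^sub>R (h *v p - p)"
      by (simp add: algebra_simps)
    then show ?thesis by (simp add: u_def c_def)
  qed
  define l where "l = 1 + p \<bullet> u"
  have "l > 0"
    using det_rank_one_update[OF h] pos by (simp add: l_def)
  have "p \<bullet> (((*v) h ^^ k) x) = l ^ k * (p \<bullet> x)" for k x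
    by (induction k) (simp_all add: h l_def inner_add_right algebra_simps)
  from this[of m p] m p have "l ^ m = 1" by simp
  with \<open>l > 0\<close> m have "l = 1"
    using power_eq_1_iff[of l m] by auto
  \<comment> \<open>Now \<open>h\<close> fixes \<open>u\<close>, so each iteration adds the same
    multiple of \<open>u\<close>; the \<open>m\<close>-th power at \<open>p\<close> leaves
    \<open>m * (p \<bullet> p)\<close> times \<open>u\<close> equal to zero.\<close>
  then have [simp]: "p \<bullet> u = 0" by (simp add: l_def)
  have "(((*v) h ^^ k) x) = x + (of_nat k * (p \<bullet> x)) *\<^sub>R u" for k x
    by (induction k) (simp_all add: h inner_add_right algebra_simps)
  from this[of m p] m p have "u = 0" by simp
  then show ?thesis
    by (intro matrix_eq[THEN iffD2]) (simp add: h)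
qed

text \<open>On the segment from the identity to \<open>g\<close> the determinant changes sign, so
  some point is singular. A kernel vector there is an eigenvector of \<open>g\<close> with
  eigenvalue \<open>l \<le> 0\<close>, and finite order gives absolute value 1.\<close>

lemma det_neg_imp_eigenvector_minus_1:
  fixes g :: "real ^ 'n ^ 'n"
  assumes m: "m > 0" "((*v) g ^^ m) = id" and neg: "det g < 0"
  obtains v where "v \<noteq> 0" "g *v v = - v"
proof -
  define f where "f t = det ((1 - t) *\<^sub>R mat 1 + t *\<^sub>R g)" for t :: real
  have cont: "continuous_on {0..1} f"
    unfolding f_def det_def by (intro continuous_intros)
  have "f 0 = 1" "f 1 = det g" by (simp_all add: f_def)
  then obtain t where t: "0 \<le> t" "t \<le> 1" "f t = 0"
    using IVT2'[of f 1 0 0] cont neg by auto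
  then have "t \<noteq> 0" using \<open>f 0 = 1\<close> by auto
  obtain v where v: "v \<noteq> 0" "((1 - t) *\<^sub>R mat 1 + t *\<^sub>R g) *v v = 0"
    using t(3) invertible_det_nz invertible_left_inverse matrix_left_invertible_ker
    unfolding f_def by metis
  define l where "l = - ((1 - t) / t)"
  have "(1 - t) *\<^sub>R v + t *\<^sub>R (g *v v) = 0"
    using v by (simp add: matrix_vector_mult_add_rdistrib scaleR_matrix_vector_assoc[symmetric])
  then have "t *\<^sub>R (g *v v) = - ((1 - t) *\<^sub>R v)"
    by (metis add.commute eq_neg_iff_add_eq_0)
  also have "\<dots> = t *\<^sub>R (l *\<^sub>R v)"
    using \<open>t \<noteq> 0\<close> by (simp add: l_def)
  finally have gv: "g *v v = l *\<^sub>R v"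
    using \<open>t \<noteq> 0\<close> by (simp only: scaleR_cancel_left simp_thms)
  have "(((*v) g ^^ k) v) = l ^ k *\<^sub>R v" for k
    by (induction k) (simp_all add: gv matrix_vector_mult_scaleR ac_simps)
  from this[of m] m(2) have "l ^ m *\<^sub>R v = 1 *\<^sub>R v"
    by simp
  with v(1) have "l ^ m = 1"
    by (simp only: scaleR_cancel_right simp_thms)
  then have "\<bar>l\<bar> = 1"
    using m power_eq_1_iff[of "\<bar>l\<bar>" m] by (auto simp: power_abs[symmetric])
  moreover have "l \<le> 0"
    using t \<open>t \<noteq> 0\<close> by (simp add: l_def)
  ultimately have "l = -1" by auto
  with v gv that show thesis by auto
qed

text \<open>If \<open>det g < 0\<close>, then \<open>g\<close> has eigenvalue \<open>-1\<close>, and composing \<open>g\<close> with a commuting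
  reflection in an eigenvector yields a map of finite order and positive determinant that fixes
  a hyperplane, hence the identity. So \<open>g\<close> is itself a reflection, against codimension two.\<close>

lemma det_pos_if_codim_fixed_space_2:
  fixes g :: "real ^ 'n ^ 'n"
  assumes m: "m > 0" "((*v) g ^^ m) = id"
    and codim: "codim (fixed_space {g}) = 2" and nz: "det g \<noteq> 0"
  shows "det g > 0"
proof (rule ccontr)
  assume "\<not> det g > 0"
  with nz have neg: "det g < 0" by simp
  obtain v where v: "v \<noteq> 0" "g *v v = - v"
    using det_neg_imp_eigenvector_minus_1[OF m neg] .
  \<comment> \<open>An even exponent makes the sign \<open>(-1) ^ (2 * m)\<close> disappear and lets
    powers be compared through squares.\<close>
  have m2: "((*v) g ^^ (2 * m)) = id"
    by (simp add: mult_2 funpow_add m)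
  define S where "S = range (\<lambda>y. g *v y + y)"
  have "linear (\<lambda>y. g *v y + y)"
    by (intro linear_compose_add) (auto simp: linear_id[unfolded id_def])
  then have subS: "subspace S"
    unfolding S_def by (rule linear_subspace_image) simp
  \<comment> \<open>Otherwise \<open>v\<close> and \<open>y\<close> would span a Jordan block for
    the eigenvalue -1, whose powers grow linearly and never return to the identity.\<close>
  have "v \<notin> S"
  proof
    assume "v \<in> S"
    then obtain y where "v = g *v y + y" by (auto simp: S_def)
    then have y: "g *v y = v - y" by (simp add: algebra_simps)
    have "((*v) g ^^ k) y = (-1) ^ k *\<^sub>R (y - of_nat k *\<^sub>R v)" for k
    proof (induction k)
      case (Suc k)
      have "((*v) g ^^ Suc k) y = g *v ((-1) ^ k *\<^sub>R (y - of_nat k *\<^sub>R v))"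
        by (simp add: Suc.IH)
      then show ?case
        by (simp add: y v matrix_vector_mult_diff_distrib algebra_simps)
    qed simp
    from this[of "2 * m"] m m2 v show False by simp
  qed
  \<comment> \<open>The part of \<open>v\<close> orthogonal to \<open>S\<close> is a dual
    eigenvector: it annihilates the image of \<open>g + 1\<close>, so the functional
    \<open>p\<close> changes sign under \<open>g\<close>, yet it does not vanish at
    \<open>v\<close>. No invariant inner product is required.\<close>
  obtain a p where p: "a \<in> span S" "\<And>w. w \<in> span S \<Longrightarrow> orthogonal p w" "v = a + p"
    using orthogonal_subspace_decomp_exists[of S v] by blast
  have "span S = S" using subS by (simp add: span_eq_iff)
  with p \<open>v \<notin> S\<close> have "p \<noteq> 0" by auto
  have "p \<bullet> v = p \<bullet> p"
    using p by (simp add: inner_add_right orthogonal_def)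
  define c where "c = 2 / (p \<bullet> v)"
  have pv: "p \<bullet> v \<noteq> 0" using \<open>p \<bullet> v = p \<bullet> p\<close> \<open>p \<noteq> 0\<close> by simp
  have pg: "p \<bullet> (g *v x) = - (p \<bullet> x)" for x
  proof -
    have "orthogonal p (g *v x + x)"
      by (rule p(2)) (use \<open>span S = S\<close> S_def in blast)
    then show ?thesis by (simp add: orthogonal_def inner_add_right)
  qed
  \<comment> \<open>The reflection, possibly oblique, that negates \<open>v\<close> and fixes the
    orthogonal complement of \<open>p\<close>.\<close>
  define s where "s = matrix (\<lambda>x. x + (p \<bullet> x) *\<^sub>R (- c *\<^sub>R v))"
  have "linear (\<lambda>x. x + (p \<bullet> x) *\<^sub>R (- c *\<^sub>R v))"
    by (intro linearI) (simp_all add: inner_add_right algebra_simps)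
  then have s: "s *v x = x + (p \<bullet> x) *\<^sub>R (- c *\<^sub>R v)" for x
    unfolding s_def by (rule matrix_vector_mul(2)[THEN fun_cong])
  have "det s = -1"
    using det_rank_one_update[OF s] pv by (simp add: c_def)
  then have pos: "det (g ** s) > 0" using neg by (simp add: det_mul)
  have gs: "(g ** s) *v x = g *v x + (c * (p \<bullet> x)) *\<^sub>R v" for x
    by (simp add: matrix_vector_mul_assoc[symmetric] s v matrix_vector_mult_scaleR
        matrix_vector_mult_diff_distrib)
  have pgs: "p \<bullet> ((g ** s) *v x) = p \<bullet> x" for x
    using pv by (simp add: gs inner_add_right pg c_def)
  \<comment> \<open>The two rank-one corrections cancel: \<open>g\<close> negates the first, while
    the second is unchanged because \<open>g ** s\<close> preserves the functional
    \<open>p\<close>.\<close>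
  have gs2: "(g ** s) *v ((g ** s) *v x) = g *v (g *v x)" for x
    unfolding gs[of "(g ** s) *v x"] pgs
    by (simp add: gs matrix_vector_right_distrib matrix_vector_mult_scaleR v)
  have "((*v) (g ** s) ^^ (2 * k)) x = ((*v) g ^^ (2 * k)) x" for k x
    by (induction k) (simp_all add: gs2)
  then have ord: "((*v) (g ** s) ^^ (2 * m)) = id"
    using m2 by (simp add: fun_eq_iff)
  define F where "F = fixed_space {g}"
  have F: "F = {x. g *v x = x}" by (simp add: F_def fixed_space_def)
  have subF: "subspace F"
    by (auto simp: F subspace_def matrix_vector_right_distrib matrix_vector_mult_scaleR)
  have dimF: "dim F + 2 = CARD('n)"
    using codim by (simp add: F_def codim_def)
  have "v \<notin> F"
  proof
    assume "v \<in> F"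
    then have "g *v v = v" by (simp add: F)
    from trans[OF v(2)[symmetric] this] have "v + v = 0"
      by (metis add.right_inverse)
    then show False using v(1) scaleR_half_double[of v] by simp
  qed
  \<comment> \<open>Adjoining \<open>v\<close> raises the codimension-two space \<open>F\<close> to
    a hyperplane. The map \<open>g ** s\<close> fixes it: both factors negate \<open>v\<close>, and
    both fix \<open>F\<close>, on which \<open>p\<close> vanishes.\<close>
  then have dimW: "dim (span (insert v F)) + 1 = CARD('n)"
    using subF dimF by (simp add: dim_insert span_eq_iff[THEN iffD2])
  have pF: "p \<bullet> x = 0" if "x \<in> F" for x
    using pg[of x] that by (simp add: F)
  have "(g ** s) *v x = x" if "x \<in> span (insert v F)" for x
    using that
  proof (induction rule: span_induct)
    case base
    show ?case
      by (auto simp: subspace_def matrix_vector_right_distrib matrix_vector_mult_scaleR)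
  next
    case (step x)
    then consider "x = v" | "x \<in> F" by auto
    then show ?case
    proof cases
      case 1
      then show ?thesis using pv by (simp add: gs v c_def scaleR_2)
    next
      case 2
      then show ?thesis using pF by (simp add: gs F)
    qed
  qed
  then have one: "g ** s = mat 1"
    using m ord pos dimW by (intro fixes_hyperplane_imp_mat_1[of "2 * m" _ "span (insert v F)"]) auto
  \<comment> \<open>Since \<open>g ** s\<close> is the identity, \<open>g\<close> agrees with it
    wherever the functional \<open>p\<close> vanishes. This puts a whole hyperplane inside
    \<open>F\<close>, whose codimension is two.\<close>
  have "{x. p \<bullet> x = 0} \<subseteq> F"
  proof
    fix x assume "x \<in> {x. p \<bullet> x = 0}"
    then show "x \<in> F" using gs[of x] by (simp add: one F)
  qed
  then have "dim {x. p \<bullet> x = 0} \<le> dim F" by (rule dim_subset)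
  with \<open>p \<noteq> 0\<close> dimF show False by (simp add: dim_hyperplane)
qed

text \<open>The group order serves as exponent. The result is phrased with iterates of the action,
  the form used in the eigenvector computations.\<close>

lemma finite_subgroup_GL_finite_order:
  fixes G :: "(real ^ 'n ^ 'n) set"
  assumes "subgroup G GL" "finite G" "g \<in> G"
  obtains m where "m > 0" "((*v) g ^^ m) = id"
proof -
  let ?G = "GL\<lparr>carrier := G\<rparr>"
  interpret group ?G
    using assms(1) group_GL by (rule subgroup.subgroup_is_group)
  have pow: "(g [^]\<^bsub>?G\<^esub> k) *v x = ((*v) g ^^ k) x" for k :: nat and x
    by (induction k arbitrary: x)
      (simp_all add: GL_def matrix_vector_mul_assoc[symmetric] funpow_swap1)
  have "g [^]\<^bsub>?G\<^esub> order ?G = mat 1"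
    using pow_order_eq_1[of g] assms by (simp add: GL_def)
  then have "((*v) g ^^ order ?G) = id"
    using pow[of "order ?G"] by (simp add: fun_eq_iff)
  moreover have "order ?G > 0"
    using assms by (auto simp: order_def card_gt_0_iff)
  ultimately show thesis by (rule that[rotated])
qed

text \<open>Positivity of the determinant survives products and inverses, so it passes from
  generators to the generated group.\<close>

lemma det_pos_generate_GL:
  fixes S :: "(real ^ 'n ^ 'n) set"
  assumes "\<And>g. g \<in> S \<Longrightarrow> g \<in> carrier GL \<and> det g > 0" and "g \<in> generate GL S"
  shows "det g > 0"
  using assms(2)
proof (induction rule: generate.induct)
  case (inv h)
  interpret group "GL :: (real ^ 'n ^ 'n) monoid" by (rule group_GL)
  have "inv\<^bsub>GL\<^esub> h ** h = mat 1"
    using l_inv[of h] assms(1)[OF inv] by (simp add: GL_def)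
  then have "det (inv\<^bsub>GL\<^esub> h) * det h = 1"
    by (metis det_I det_mul)
  then show ?case
    using assms(1)[OF inv] by (metis zero_less_mult_pos2 zero_less_one)
qed (use assms(1) in \<open>auto simp: GL_def det_mul\<close>)

theorem proposition4p2:
  fixes G :: "(real ^ 'n ^ 'n) set"
  assumes "subgroup G GL"
    and "finite G"
    and "strictly_generated_in_codim_two G"
  shows "subspace_arrangement_codim G 1 = {}"
proof (rule ccontr)
  assume "subspace_arrangement_codim G 1 \<noteq> {}"
  then obtain H where H: "subgroup H GL" "H \<subseteq> G" "H \<noteq> {\<one>\<^bsub>GL\<^esub>}"
      and codim: "codim (fixed_space H) = 1"
    by (auto simp: subspace_arrangement_codim_def subspace_arrangement_def stabilizer_subgroup_def)
  have "\<one>\<^bsub>GL\<^esub> \<in> H" using H(1) by (rule subgroup.one_closed)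
  with H(3) obtain h where h: "h \<in> H" "h \<noteq> mat 1" by (auto simp: GL_def)
  have GL: "G \<subseteq> carrier GL" using assms(1) by (rule subgroup.subset)
  have "det g > 0" if g: "g \<in> G" "codim (fixed_space {g}) = 2" for g
  proof -
    obtain m where "m > 0" "((*v) g ^^ m) = id"
      using finite_subgroup_GL_finite_order[OF assms(1,2) g(1)] .
    moreover have "det g \<noteq> 0"
      using GL g by (auto simp: GL_def invertible_det_nz)
    ultimately show ?thesis
      using g(2) by (intro det_pos_if_codim_fixed_space_2)
  qed
  moreover have "h \<in> generate GL {g \<in> G. codim (fixed_space {g}) = 2}"
    using assms(3) H h by (auto simp: strictly_generated_in_codim_two_def)
  ultimately have pos: "det h > 0"
    using GL by (intro det_pos_generate_GL[of "{g \<in> G. codim (fixed_space {g}) = 2}"]) auto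
  have "h \<in> G" using H h by auto
  then obtain m where "m > 0" "((*v) h ^^ m) = id"
    by (rule finite_subgroup_GL_finite_order[OF assms(1,2)])
  moreover have "subspace (fixed_space H)"
    by (auto simp: fixed_space_def subspace_def matrix_vector_right_distrib matrix_vector_mult_scaleR)
  \<comment> \<open>A truncated difference would be 0, so codimension 1 yields a genuine equation
    between dimensions.\<close>
  moreover have "dim (fixed_space H) + 1 = CARD('n)"
    using codim by (simp add: codim_def)
  moreover have "h *v x = x" if "x \<in> fixed_space H" for x
    using that h by (simp add: fixed_space_def)
  ultimately have "h = mat 1"
    using pos by (rule fixes_hyperplane_imp_mat_1)
  with h show False by simp
qed

end
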